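(* Let $c \geq 7$ be an integer and let $K^*_{c+1}$ be the graph obtained from the complete graph on $c+1$ vertices by subdividing every edge exactly once. If $G$ is a graph with $\operatorname{mad}(G) \leq \operatorname{mad}(K^*_{c+1}) = \frac{4c}{c+2}$, then $\chi_o(G) \leq c$, unless $G$ contains $K^*_{c+1}$ as a subgraph. (That is, if $\operatorname{mad}(G)\le \frac{4c}{c+2}$ and $G$ does not contain $K^*_{c+1}$ as a subgraph, then $\chi_o(G)\le c$.)
   Context: All graphs are finite and simple (no loops, no parallel edges). The maximum average degree $\operatorname{mad}(G)$ of a graph $G$ is the maximum of $\frac{2|E(H)|}{|V(H)|}$ over all non-empty subgraphs $H$ of $G$. An odd $c$-coloring of a graph is a proper coloring of its vertices with (at most) $c$ colors such that, for each vertex $v$ of positive degree, some color appears an odd number of times on the neighborhood of $v$. A graph is odd $c$-colorable if it has an odd $c$-coloring. The odd chromatic number $\chi_o(G)$ is the minimum $c$ such that $G$ has an odd $c$-coloring. *)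

theory Defs
  imports Complex_Main "Graph_Theory.Graph_Theory"
begin

text \<open>
  A finite simple graph is a \<^locale>\<open>pair_graph\<close>: a finite, loop-free, symmetric set of arcs given
  as ordered pairs. Every undirected edge thus corresponds to two opposite arcs.
\<close>

definition uedges :: "'a pair_pre_digraph \<Rightarrow> 'a set set" where
  "uedges G = {{u, v} | u v. (u, v) \<in> parcs G}"

definition neighborhood :: "'a pair_pre_digraph \<Rightarrow> 'a \<Rightarrow> 'a set" where
  "neighborhood G v = {w. (v, w) \<in> parcs G}"

text \<open>
  Subgraphs must themselves be symmetric, hence the requirement \<^const>\<open>pair_graph\<close>. The maximum
  ranges over a finite set, which is nonempty unless \<open>G\<close> has no vertices; for the graph without
  vertices the value is unspecified.
\<close>

definition mad :: "'a pair_pre_digraph \<Rightarrow> real" where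
  "mad G = Max {2 * real (card (uedges H)) / real (card (pverts H)) | H.
     pair_graph H \<and> subgraph (with_proj H) (with_proj G) \<and> pverts H \<noteq> {}}"

definition proper_coloring :: "'a pair_pre_digraph \<Rightarrow> ('a \<Rightarrow> nat) \<Rightarrow> bool" where
  "proper_coloring G f \<longleftrightarrow> (\<forall>(u, v) \<in> parcs G. f u \<noteq> f v)"

text \<open>In a symmetric digraph the out-degree is the degree of the undirected graph.\<close>

definition odd_coloring :: "'a pair_pre_digraph \<Rightarrow> nat \<Rightarrow> ('a \<Rightarrow> nat) \<Rightarrow> bool" where
  "odd_coloring G c f \<longleftrightarrow>
     f ` pverts G \<subseteq> {..<c} \<and>
     proper_coloring G f \<and>
     (\<forall>v \<in> pverts G. out_degree (with_proj G) v > 0 \<longrightarrow>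
        (\<exists>k. odd (card {w \<in> neighborhood G v. f w = k})))"

definition odd_colorable :: "'a pair_pre_digraph \<Rightarrow> nat \<Rightarrow> bool" where
  "odd_colorable G c \<longleftrightarrow> (\<exists>f. odd_coloring G c f)"

definition odd_chromatic_number :: "'a pair_pre_digraph \<Rightarrow> nat" (\<open>\<chi>\<^sub>o\<close>) where
  "\<chi>\<^sub>o G = (LEAST c. odd_colorable G c)"

definition complete_graph :: "nat \<Rightarrow> nat pair_pre_digraph" where
  "complete_graph n =
     \<lparr> pverts = {..<n}, parcs = {(u, v). u < n \<and> v < n \<and> u \<noteq> v} \<rparr>"

text \<open>
  Subdividing every edge exactly once: \<open>Inl u\<close> is the original vertex \<open>u\<close>, and \<open>Inr e\<close> is the new
  vertex in the middle of the edge \<open>e\<close>, adjacent to the two ends of \<open>e\<close>.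
\<close>

definition subdivide_all :: "'a pair_pre_digraph \<Rightarrow> ('a + 'a set) pair_pre_digraph" where
  "subdivide_all G =
     \<lparr> pverts = Inl ` pverts G \<union> Inr ` uedges G,
       parcs = {(Inl u, Inr e) | u e. e \<in> uedges G \<and> u \<in> e}
             \<union> {(Inr e, Inl u) | u e. e \<in> uedges G \<and> u \<in> e} \<rparr>"

definition K_star :: "nat \<Rightarrow> (nat + nat set) pair_pre_digraph" where
  "K_star n = subdivide_all (complete_graph n)"

text \<open>Containment as a (not necessarily induced) subgraph is up to isomorphism.\<close>

definition contains_subgraph :: "'a pair_pre_digraph \<Rightarrow> 'b pair_pre_digraph \<Rightarrow> bool" where
  "contains_subgraph G K \<longleftrightarrow>
     (\<exists>H. subgraph (with_proj H) (with_proj G) \<and> digraph_iso (with_proj K) (with_proj H))"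

lemma complete_graph_complete_digraph: "complete_digraph n (with_proj (complete_graph n))"
  by (auto simp: complete_digraph_pair_def complete_graph_def)

lemma pair_graph_subdivide_all:
  assumes "pair_graph G"
  shows "pair_graph (subdivide_all G)"
proof -
  interpret pair_graph G by fact
  have sub: "uedges G \<subseteq> Pow (pverts G)"
    by (auto simp: uedges_def dest: in_arcsD1 in_arcsD2)
  have fin: "finite (pverts (subdivide_all G))"
    using pair_finite_verts finite_subset[OF sub] by (simp add: subdivide_all_def)
  have wf: "parcs (subdivide_all G) \<subseteq> pverts (subdivide_all G) \<times> pverts (subdivide_all G)"
    using sub by (auto simp: subdivide_all_def)
  show ?thesis
  proof
    show "finite (parcs (subdivide_all G))"
      using fin wf by (meson finite_SigmaI finite_subset)
    show "symmetric (with_proj (subdivide_all G))"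
      by (auto simp: symmetric_def subdivide_all_def intro!: symI)
  next
    fix a assume a: "a \<in> parcs (subdivide_all G)"
    show "fst a \<in> pverts (subdivide_all G)" and "snd a \<in> pverts (subdivide_all G)"
      using subsetD[OF wf a] by (simp_all add: mem_Times_iff)
    show "fst a \<noteq> snd a"
      using a by (auto simp: subdivide_all_def)
  qed (fact fin)
qed

lemma pair_graph_K_star: "pair_graph (K_star n)"
  unfolding K_star_def
  by (intro pair_graph_subdivide_all pair_graphI_complete[OF complete_graph_complete_digraph])

end

theory Submission
  imports Defs
begin

text \<open>
  In a minimal counterexample (with \<open>k = c\<close> colors), delete a vertex \<open>v\<close> together with its \<open>t\<close>
  neighbours of degree two and color the rest. A color for \<open>v\<close> is excluded at most once by each
  deleted neighbour and at most twice by each other one, so \<open>2 d(v) - t \<ge> k\<close> unless \<open>t = 0\<close> and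
  \<open>d(v)\<close> is even and positive. Let every vertex of degree at least four give \<open>(k - 2) / (k + 2)\<close>
  to each neighbour of degree two. Then everybody ends up with charge at least \<open>4 k / (k + 2)\<close>, and
  the bound on the average degree forces equality: all vertices of degree other than two have degree
  \<open>k\<close> and only neighbours of degree two. The graph is thus a subdivided \<open>k\<close>-regular multigraph
  without \<open>K\<^bsub>k+1\<^esub>\<close>. Brooks' theorem colors its branch vertices, and the subdivision vertices,
  whose neighbours have distinct colors, can be colored greedily.
\<close>

section \<open>Brooks' theorem\<close>

lemma ex_color_notin:
  fixes A :: "nat set"
  assumes "card A < k" "finite A"
  shows "\<exists>a<k. a \<notin> A"
proof (rule ccontr)
  assume "\<not> ?thesis"
  then have "{..<k} \<subseteq> A" by auto
  from card_mono[OF assms(2) this] assms(1) show False by simp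
qed

locale simple_adjacency =
  fixes E :: "'a rel"
  assumes sym_E: "sym E" and irrefl_E: "irrefl E"
begin

lemma E_sym: "(u, v) \<in> E \<longleftrightarrow> (v, u) \<in> E"
  using sym_E by (auto dest: symD)

lemma E_irrefl [simp]: "(u, u) \<notin> E"
  using irrefl_E by (auto simp: irrefl_def)

text \<open>Taking neighbours inside \<open>S\<close> replaces the formation of induced subgraphs:
  deleting vertices only shrinks \<open>S\<close>, while \<open>E\<close> stays fixed.\<close>

definition nb :: "'a set \<Rightarrow> 'a \<Rightarrow> 'a set" where
  "nb S v = {w \<in> S. (v, w) \<in> E}"

lemma in_nb_iff [simp]: "w \<in> nb S v \<longleftrightarrow> w \<in> S \<and> (v, w) \<in> E"
  by (simp add: nb_def)

lemma finite_nb [simp, intro]: "finite S \<Longrightarrow> finite (nb S v)"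
  by (simp add: nb_def)

lemma nb_mono: "S \<subseteq> T \<Longrightarrow> nb S v \<subseteq> nb T v"
  by auto

lemma card_nb_mono: "finite T \<Longrightarrow> S \<subseteq> T \<Longrightarrow> card (nb S v) \<le> card (nb T v)"
  by (intro card_mono finite_nb nb_mono)

definition pcol :: "nat \<Rightarrow> 'a set \<Rightarrow> ('a \<Rightarrow> nat) \<Rightarrow> bool" where
  "pcol k S f \<longleftrightarrow> (\<forall>v\<in>S. f v < k) \<and> (\<forall>u\<in>S. \<forall>v\<in>S. (u, v) \<in> E \<longrightarrow> f u \<noteq> f v)"

lemma pcol_insert:
  assumes "pcol k S f" "x \<notin> S" "a < k" "\<And>u. u \<in> nb S x \<Longrightarrow> a \<noteq> f u"
  shows "pcol k (insert x S) (f(x := a))"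
  unfolding pcol_def
proof (intro conjI ballI impI)
  show "(f(x := a)) v < k" if "v \<in> insert x S" for v
    using that assms by (auto simp: pcol_def)
  show "(f(x := a)) u \<noteq> (f(x := a)) v"
    if "u \<in> insert x S" "v \<in> insert x S" "(u, v) \<in> E" for u v
    using that assms E_sym[of u v] by (auto simp: pcol_def)
qed

lemma pcol_greedy:
  assumes "pcol k S f" "x \<notin> S" "finite S" "card (f ` nb S x) < k"
  shows "\<exists>a. pcol k (insert x S) (f(x := a))"
proof -
  obtain a where "a < k" "a \<notin> f ` nb S x"
    using ex_color_notin[OF assms(4)] assms(3) by auto
  then show ?thesis using pcol_insert[OF assms(1,2)] by (metis imageI)
qed

text \<open>Color the path from its front. When a vertex is reached, its successor in
  \<open>xs @ [y]\<close> is still uncolored, so at most \<open>k - 1\<close> of its neighbours are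
  colored. The last vertex \<open>y\<close> only serves as such a successor and stays
  uncolored.\<close>

lemma pcol_path:
  assumes "pcol k S f" "finite W" "S \<subseteq> W" "set (xs @ [y]) \<subseteq> W - S" "distinct (xs @ [y])"
    and "successively (\<lambda>x y. (x, y) \<in> E) (xs @ [y])"
    and "\<forall>v\<in>W. card (nb W v) \<le> k"
  shows "\<exists>f'. pcol k (S \<union> set xs) f' \<and> (\<forall>v\<in>S. f' v = f v)"
  using assms
proof (induction xs arbitrary: S f)
  case Nil
  show ?case by (rule exI[of _ f]) (use Nil.prems(1) in simp)
next
  case (Cons x xs)
  let ?z = "hd (xs @ [y])"
  have "(x, ?z) \<in> E"
    using Cons.prems(6) by (cases xs) simp_all
  moreover have "?z \<in> W - S"
    using Cons.prems(4) by (cases xs) simp_all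
  ultimately have z: "?z \<in> nb W x" "?z \<notin> nb S x"
    by simp_all
  have fin: "finite S" using Cons.prems finite_subset by blast
  have "nb S x \<subset> nb W x" using z nb_mono[OF Cons.prems(3)] by blast
  then have "card (nb S x) < card (nb W x)"
    using Cons.prems(2) by (intro psubset_card_mono) auto
  moreover have "card (nb W x) \<le> k" using Cons.prems(4,7) by simp
  moreover have "card (f ` nb S x) \<le> card (nb S x)" using fin by (intro card_image_le) auto
  ultimately have "card (f ` nb S x) < k" by linarith
  then obtain a where a: "pcol k (insert x S) (f(x := a))"
    using pcol_greedy[OF Cons.prems(1) _ fin] Cons.prems(4) by auto
  have "\<exists>f'. pcol k (insert x S \<union> set xs) f' \<and> (\<forall>v\<in>insert x S. f' v = (f(x := a)) v)"
  proof (rule Cons.IH[OF a Cons.prems(2)])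
    show "insert x S \<subseteq> W" "set (xs @ [y]) \<subseteq> W - insert x S" "distinct (xs @ [y])"
      using Cons.prems(3-5) by auto
    show "successively (\<lambda>x y. (x, y) \<in> E) (xs @ [y])"
      using Cons.prems(6) by (simp add: successively_Cons)
  qed (rule Cons.prems(7))
  then obtain f' where f': "pcol k (insert x S \<union> set xs) f'"
    "\<forall>v\<in>insert x S. f' v = (f(x := a)) v" by blast
  have "x \<notin> S" using Cons.prems(4) by simp
  have "pcol k (S \<union> set (x # xs)) f'" using f'(1) by simp
  moreover have "f' v = f v" if "v \<in> S" for v
    using f'(2)[rule_format, of v] that \<open>x \<notin> S\<close> by (metis fun_upd_other insertCI)
  ultimately show ?case by blast
qed

text \<open>All neighbours of \<open>y\<close> may be colored by the time it is reached, but
  \<open>p\<close> and \<open>q\<close> share a color, so at most \<open>k - 1\<close> colors occur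
  among them.\<close>

lemma pcol_path_close:
  assumes "pcol k S f" "finite W" "S \<subseteq> W" "set (xs @ [y]) \<subseteq> W - S" "distinct (xs @ [y])"
    and "successively (\<lambda>x y. (x, y) \<in> E) (xs @ [y])"
    and deg: "\<forall>v\<in>W. card (nb W v) \<le> k"
    and pq: "p \<in> nb S y" "q \<in> nb S y" "p \<noteq> q" "f p = f q"
  shows "\<exists>f'. pcol k (S \<union> set (xs @ [y])) f'"
proof -
  from pcol_path[OF assms(1-7)] obtain f' where
    f': "pcol k (S \<union> set xs) f'" "\<forall>v\<in>S. f' v = f v" by blast
  let ?S = "S \<union> set xs" and ?N = "nb (S \<union> set xs) y"
  have fin: "finite ?S" using assms finite_subset by blast
  have "f' p = f' q" using f' pq by auto
  moreover have "q \<in> ?N - {p}" using pq(2,3) by auto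
  ultimately have "f' p \<in> f' ` (?N - {p})" by (metis image_eqI)
  then have "f' ` ?N \<subseteq> f' ` (?N - {p})" by blast
  then have "card (f' ` ?N) \<le> card (f' ` (?N - {p}))" using fin by (intro card_mono) auto
  also have "\<dots> \<le> card (?N - {p})" using fin by (intro card_image_le) auto
  also have "\<dots> < card ?N" using fin pq(1) by (intro card_Diff1_less) simp_all
  also have "\<dots> \<le> card (nb W y)" using assms by (intro card_nb_mono) auto
  also have "\<dots> \<le> k" using assms by auto
  finally have "\<exists>a. pcol k (insert y ?S) (f'(y := a))"
    using assms fin by (intro pcol_greedy[OF f'(1)]) auto
  then show ?thesis by (auto simp: insert_commute)
qed

text \<open>
  The argument of Zajac: close up a maximal path starting with \<open>v1, v2, v3\<close>, where \<open>v1\<close> and \<open>v3\<close> are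
  nonadjacent, to a cycle through all neighbours of its last vertex. If the cycle misses some vertex,
  color its complement by induction and go around the cycle, beginning just after the last vertex
  \<open>y\<close> with an outside neighbour \<open>u\<close> by repeating the color of \<open>u\<close>; then \<open>y\<close> sees that color
  twice. Otherwise \<open>v1\<close> and \<open>v3\<close> share a color and \<open>v2\<close> comes last.
\<close>

theorem brooks:
  assumes "finite V" "k \<ge> 3" "\<forall>v\<in>V. card (nb V v) \<le> k"
    and "\<And>K. K \<subseteq> V \<Longrightarrow> card K = Suc k \<Longrightarrow> \<exists>x\<in>K. \<exists>y\<in>K. x \<noteq> y \<and> (x, y) \<notin> E"
  shows "\<exists>f. pcol k V f"
  using assms
proof (induction V rule: finite_psubset_induct)
  case (psubset V)
  note fin = psubset.hyps and deg = psubset.prems(2)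
  have IH: "\<exists>f. pcol k W f" if W: "W \<subset> V" for W
  proof (rule psubset.IH[OF W \<open>3 \<le> k\<close>])
    show "\<forall>v\<in>W. card (nb W v) \<le> k"
    proof
      fix v assume "v \<in> W"
      then have "card (nb V v) \<le> k" using deg W by blast
      moreover have "card (nb W v) \<le> card (nb V v)" using fin W by (intro card_nb_mono) auto
      ultimately show "card (nb W v) \<le> k" by linarith
    qed
  qed (use psubset.prems(3) W in blast)
  show ?case
  proof (cases "V = {} \<or> (\<exists>v\<in>V. card (nb V v) < k)")
    case True
    then consider "V = {}" | v where "v \<in> V" "card (nb V v) < k" by blast
    then show ?thesis
    proof cases
      case 1
      then show ?thesis by (simp add: pcol_def)
    next
      case 2
      then obtain f where f: "pcol k (V - {v}) f" using IH[of "V - {v}"] by auto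
      have "card (f ` nb (V - {v}) v) \<le> card (nb (V - {v}) v)"
        using fin by (intro card_image_le) auto
      also have "\<dots> \<le> card (nb V v)" using fin by (intro card_nb_mono) auto
      finally have "\<exists>a. pcol k (insert v (V - {v})) (f(v := a))"
        using 2 fin by (intro pcol_greedy[OF f]) auto
      moreover have "insert v (V - {v}) = V" using 2 by auto
      ultimately show ?thesis by auto
    qed
  next
    case False
    then have reg: "card (nb V v) = k" if "v \<in> V" for v using deg that by force
    from False obtain v2 where v2: "v2 \<in> V" by blast
    \<comment> \<open>The closed neighbourhood has \<open>k + 1\<close> vertices, so it is not a
      clique. A nonadjacent pair in it cannot involve \<open>v2\<close>.\<close>
    have "card (insert v2 (nb V v2)) = Suc k" using fin reg[OF v2] by auto
    moreover have "insert v2 (nb V v2) \<subseteq> V" using v2 by auto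
    ultimately obtain v1 v3 where
      "v1 \<in> insert v2 (nb V v2)" "v3 \<in> insert v2 (nb V v2)" "v1 \<noteq> v3" "(v1, v3) \<notin> E"
      using psubset.prems(3) by blast
    then have v13: "v1 \<in> V" "v3 \<in> V" "(v2, v1) \<in> E" "(v2, v3) \<in> E" "v1 \<noteq> v3" "(v1, v3) \<notin> E"
      by (auto simp: E_sym[of _ v2])
    then have ne: "v1 \<noteq> v2" "v3 \<noteq> v2" by auto
    let ?path = "\<lambda>P. set P \<subseteq> V \<and> distinct P \<and> successively (\<lambda>x y. (x, y) \<in> E) P"
    let ?Q = "\<lambda>r. ?path (v1 # v2 # v3 # r)"
    have "?Q []" using v13 v2 ne by (auto simp: E_sym[of v1 v2])
    moreover have "\<forall>r. ?Q r \<longrightarrow> length r < Suc (card V)"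
    proof (intro allI impI)
      fix r assume "?Q r"
      then have "length r = card (set r)" "set r \<subseteq> V" by (auto simp: distinct_card)
      then show "length r < Suc (card V)" using card_mono[OF fin, of "set r"] by simp
    qed
    ultimately obtain r where r: "?Q r" and rmax: "\<And>r'. ?Q r' \<Longrightarrow> length r' \<le> length r"
      using ex_has_greatest_nat[of ?Q "[]" length] by metis
    define P where "P = v1 # v2 # v3 # r"
    have P: "?path P" using r by (simp add: P_def)
    define z where "z = last P"
    have z: "z \<in> V" "z \<in> set P" using P by (auto simp: z_def P_def)
    have nbz: "nb V z \<subseteq> set P"
    proof (rule ccontr)
      assume "\<not> nb V z \<subseteq> set P"
      then obtain y where y: "y \<in> V" "(z, y) \<in> E" "y \<notin> set P" by (meson in_nb_iff subsetI)
      then have "?path (P @ [y])" using P by (auto simp: successively_append_iff z_def)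
      then have "?Q (r @ [y])" by (simp add: P_def)
      from rmax[OF this] show False by simp
    qed
    have "nb V z \<noteq> {}" using reg[OF z(1)] psubset.prems(1) by auto
    then obtain x0 where "x0 \<in> nb V z" by blast
    then have "\<exists>x\<in>set P. (x, z) \<in> E" using nbz E_sym[of z x0] by auto
    \<comment> \<open>As \<open>x\<close> is the first neighbour of \<open>z\<close> on the path,
      the part from \<open>x\<close> on closes to a cycle containing every neighbour of
      \<open>z\<close>.\<close>
    then obtain A x B where AB: "P = A @ x # B" "(x, z) \<in> E" "\<forall>y\<in>set A. (y, z) \<notin> E"
      using split_list_first_prop[of P "\<lambda>x. (x, z) \<in> E"] by blast
    let ?C = "x # B"
    have nbzC: "nb V z \<subseteq> set ?C"
    proof
      fix v assume v: "v \<in> nb V z"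
      then have "v \<in> set P" "(v, z) \<in> E" using nbz E_sym[of z v] by auto
      then show "v \<in> set ?C" using AB by auto
    qed
    have C: "?path ?C" using P by (auto simp: AB successively_append_iff)
    have zl: "z = last ?C" by (simp add: z_def AB(1))
    show ?thesis
    proof (cases "set ?C = V")
      case True
      then have "A = []" using P AB(1) by (cases A) auto
      then have PV: "set P = V" using AB True by simp
      \<comment> \<open>Since \<open>k \<ge> 3\<close>, there is a third neighbour \<open>u\<close>
        of \<open>v2\<close>; the path visits all of \<open>V\<close>, so \<open>u\<close> lies in
        \<open>r\<close>.\<close>
      have "\<not> nb V v2 \<subseteq> {v1, v3}"
      proof
        assume "nb V v2 \<subseteq> {v1, v3}"
        then have "card (nb V v2) \<le> card {v1, v3}" by (intro card_mono) auto
        also have "\<dots> \<le> 2" by (simp add: card_insert_if)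
        finally show False using reg[OF v2] psubset.prems(1) by simp
      qed
      then obtain u where "u \<in> V" "(v2, u) \<in> E" "u \<noteq> v1" "u \<noteq> v3"
        by (metis in_nb_iff insertCI subsetI)
      moreover from this have "u \<in> set r" using PV[symmetric] by (auto simp: P_def)
      then obtain R1 R2 where R: "r = R1 @ u # R2" by (meson split_list)
      ultimately have u: "(u, v2) \<in> E" using E_sym by blast
      \<comment> \<open>The order is \<open>v1\<close> and \<open>v3\<close> with equal colors,
        \<open>R1\<close> forwards, \<open>R2\<close> backwards, \<open>u\<close>, and finally
        \<open>v2\<close>. After the first two, each vertex except \<open>v2\<close> precedes an
        uncolored neighbour.\<close>
      define f0 where "f0 = (\<lambda>_ :: 'a. 0 :: nat)"
      have f0: "pcol k {v1, v3} f0"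
        using psubset.prems(1) v13 E_sym by (auto simp: pcol_def f0_def)
      have PR: "set (v1 # v2 # v3 # R1 @ u # R2) = V" "distinct (v1 # v2 # v3 # R1 @ u # R2)"
        "successively (\<lambda>x y. (x, y) \<in> E) (v1 # v2 # v3 # R1 @ u # R2)"
        using P PV by (simp_all add: P_def R)
      have s1: "successively (\<lambda>x y. (x, y) \<in> E) (R1 @ [u])"
        and s2: "successively (\<lambda>x y. (x, y) \<in> E) (u # R2)"
        using PR(3) by (auto simp: successively_append_iff successively_Cons)
      obtain f1 where f1: "pcol k ({v1, v3} \<union> set R1) f1" "\<forall>v\<in>{v1, v3}. f1 v = f0 v"
      proof (atomize_elim, rule pcol_path[OF f0 fin _ _ _ s1 deg])
        show "{v1, v3} \<subseteq> V" "set (R1 @ [u]) \<subseteq> V - {v1, v3}" "distinct (R1 @ [u])"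
          using v13 PR(1,2) by auto
      qed
      have "successively (\<lambda>x y. (y, x) \<in> E) (u # R2)"
        by (rule successively_mono[OF s2]) (use E_sym in blast)
      then have "successively (\<lambda>x y. (x, y) \<in> E) (rev (u # R2))"
        by (simp only: successively_rev)
      then have s3: "successively (\<lambda>x y. (x, y) \<in> E) ((rev R2 @ [u]) @ [v2])"
        using u by (auto simp: successively_append_iff)
      have "\<exists>f'. pcol k (({v1, v3} \<union> set R1) \<union> set ((rev R2 @ [u]) @ [v2])) f'"
        by (rule pcol_path_close[OF f1(1) fin _ _ _ s3 deg, of v1 v3])
          (use PR(1,2) f1 v13 in \<open>auto simp: f0_def\<close>)
      moreover have "({v1, v3} \<union> set R1) \<union> set ((rev R2 @ [u]) @ [v2]) = V"
        using PR(1) by auto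
      ultimately show ?thesis by simp
    next
      case False
      let ?D = "V - set ?C"
      have DV: "?D \<subset> V" using C by auto
      obtain f where f: "pcol k ?D f" using IH[OF DV] by blast
      show ?thesis
      proof (cases "\<exists>y\<in>set ?C. nb ?D y \<noteq> {}")
        case False
        \<comment> \<open>No edge leaves the cycle, so colorings of its vertices and of the
          complement can be glued.\<close>
        obtain g where g: "pcol k (set ?C) g" using IH[of "set ?C"] C \<open>set ?C \<noteq> V\<close> by blast
        have nE: "(u, v) \<notin> E" "(v, u) \<notin> E" if "u \<in> set ?C" "v \<in> V" "v \<notin> set ?C" for u v
        proof -
          have "v \<notin> nb ?D u" using False that(1) by blast
          then show "(u, v) \<notin> E" "(v, u) \<notin> E" using that(2,3) E_sym[of u v] by auto
        qed
        have "pcol k V (\<lambda>v. if v \<in> set ?C then g v else f v)"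
          using f g nE unfolding pcol_def by (simp split: if_split)
        then show ?thesis by blast
      next
        case True
        then obtain C1 y C2 where C12: "?C = C1 @ y # C2" "nb ?D y \<noteq> {}"
          "\<forall>v\<in>set C2. \<not> nb ?D v \<noteq> {}"
          using split_list_last_prop[of ?C "\<lambda>y. nb ?D y \<noteq> {}"] by blast
        from C12(2) obtain u where u: "u \<in> ?D" "(y, u) \<in> E" by (metis all_not_in_conv in_nb_iff)
        \<comment> \<open>All neighbours of \<open>z\<close> lie on the cycle, so \<open>y\<close>
          is not \<open>z\<close> and has a successor \<open>w\<close>.\<close>
        have "C2 \<noteq> []"
        proof
          assume "C2 = []"
          then have "y = z" using zl C12 by simp
          then show False using u nbzC by auto
        qed
        then obtain w C3 where w: "C2 = w # C3" by (cases C2) auto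
        have nbw: "nb ?D w = {}" using C12 w by auto
        have Cs: "set (C1 @ y # w # C3) = set ?C" "distinct (C1 @ y # w # C3)"
          "successively (\<lambda>x y. (x, y) \<in> E) (C1 @ y # w # C3)"
          using C C12(1) w by simp_all
        have wD: "w \<notin> ?D" using Cs(1) by auto
        have f1: "pcol k (insert w ?D) (f(w := f u))"
          by (rule pcol_insert[OF f wD]) (use f u nbw in \<open>auto simp: pcol_def\<close>)
        have yw: "(y, w) \<in> E" using Cs(3) by (auto simp: successively_append_iff)
        have hd: "hd (C1 @ [y]) = x" using C12(1) by (cases C1) auto
        have last: "last (w # C3) = z" using zl C12(1) w by simp
        \<comment> \<open>After \<open>w\<close> the order runs through \<open>C3\<close>, over the
          closing edge from \<open>z\<close> to \<open>x\<close>, through \<open>C1\<close>, and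
          ends in \<open>y\<close>.\<close>
        have s: "successively (\<lambda>x y. (x, y) \<in> E) ((C3 @ C1) @ [y])"
        proof -
          have "successively (\<lambda>x y. (x, y) \<in> E) (C1 @ [y])"
            "successively (\<lambda>x y. (x, y) \<in> E) C3"
            using Cs(3) by (auto simp: successively_append_iff successively_Cons)
          moreover have "C3 \<noteq> [] \<Longrightarrow> (last C3, hd (C1 @ [y])) \<in> E"
            using hd last AB(2) E_sym by auto
          ultimately show ?thesis by (auto simp: successively_append_iff)
        qed
        have "u \<noteq> w" using u wD by auto
        have "set ?C \<subseteq> V" using C by simp
        have "\<exists>f'. pcol k (insert w ?D \<union> set ((C3 @ C1) @ [y])) f'"
          by (rule pcol_path_close[OF f1 fin _ _ _ s deg, of u w])
            (use Cs(1,2) \<open>set ?C \<subseteq> V\<close> u yw \<open>u \<noteq> w\<close> in auto)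
        moreover have "insert w ?D \<union> set ((C3 @ C1) @ [y]) = V"
          using Cs(1) \<open>set ?C \<subseteq> V\<close> by auto
        ultimately show ?thesis by simp
      qed
    qed
  qed
qed

end

section \<open>Extending odd colorings\<close>

definition odd_at :: "('a \<Rightarrow> nat) \<Rightarrow> 'a set \<Rightarrow> bool" where
  "odd_at f X \<longleftrightarrow> (\<exists>k. odd (card {w \<in> X. f w = k}))"

definition odd_col :: "('a \<Rightarrow> nat) \<Rightarrow> 'a set \<Rightarrow> nat" where
  "odd_col f X = (SOME k. odd (card {w \<in> X. f w = k}))"

lemma odd_at_cong:
  assumes "\<And>w. w \<in> X \<Longrightarrow> f w = g w"
  shows "odd_at f X \<longleftrightarrow> odd_at g X"
proof -
  have "{w \<in> X. f w = k} = {w \<in> X. g w = k}" for k using assms by auto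
  then show ?thesis by (simp add: odd_at_def)
qed

text \<open>
  If \<open>X\<close> has no color of odd multiplicity, then \<open>odd_col f X\<close> is arbitrary, but the new color
  becomes one. Hence in every case a single color has to be avoided.
\<close>

lemma odd_at_insert:
  assumes "finite X" "x \<notin> X" "a \<noteq> odd_col f X"
  shows "odd_at (f(x := a)) (insert x X)"
proof (cases "odd_at f X")
  case True
  then have "odd (card {w \<in> X. f w = odd_col f X})"
    unfolding odd_at_def odd_col_def by (rule someI_ex)
  moreover have "{w \<in> insert x X. (f(x := a)) w = odd_col f X} = {w \<in> X. f w = odd_col f X}"
    using assms by auto
  ultimately show ?thesis unfolding odd_at_def by metis
next
  case False
  then have "even (card {w \<in> X. f w = a})" by (simp add: odd_at_def)
  moreover have "{w \<in> insert x X. (f(x := a)) w = a} = insert x {w \<in> X. f w = a}"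
    using assms by auto
  moreover have "card (insert x {w \<in> X. f w = a}) = Suc (card {w \<in> X. f w = a})"
    using assms by simp
  ultimately show ?thesis unfolding odd_at_def by (metis even_Suc)
qed

text \<open>The color classes partition \<open>X\<close>; if all of them were even, so would be
  \<open>card X\<close>.\<close>

lemma odd_at_if_odd_card:
  assumes "finite X" "odd (card X)"
  shows "odd_at f X"
proof (rule ccontr)
  assume "\<not> odd_at f X"
  then have "even (\<Sum>k\<in>f ` X. card {w \<in> X. f w = k})"
    by (intro dvd_sum) (simp add: odd_at_def)
  also have "(\<Sum>k\<in>f ` X. card {w \<in> X. f w = k}) = card X"
    using sum.image_gen[OF assms(1), of "\<lambda>_. 1 :: nat" f] by simp
  finally show False using assms(2) by simp
qed

lemma odd_at_pair:
  assumes "f p \<noteq> f q"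
  shows "odd_at f {p, q}"
proof -
  have "{w \<in> {p, q}. f w = f p} = {p}" using assms by auto
  then show ?thesis unfolding odd_at_def by (intro exI[of _ "f p"]) simp
qed

section \<open>Partial odd colorings and reducible configurations\<close>

context simple_adjacency
begin

text \<open>The vertices in \<open>B\<close> are exempt from the parity condition.\<close>

definition odd_pcol :: "nat \<Rightarrow> 'a set \<Rightarrow> 'a set \<Rightarrow> ('a \<Rightarrow> nat) \<Rightarrow> bool" where
  "odd_pcol k S B f \<longleftrightarrow> pcol k S f \<and> (\<forall>v\<in>S - B. nb S v \<noteq> {} \<longrightarrow> odd_at f (nb S v))"

text \<open>Only the neighbourhoods of the neighbours of \<open>x\<close> grow, and each such
  neighbour forbids its own color and the one of \<open>odd_col\<close>. A vertex whose exemption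
  ends must be a neighbour of \<open>x\<close>: by \<open>odd_at_insert\<close> the new color then
  gives it a color of odd multiplicity whatever the state before.\<close>

lemma odd_pcol_insert:
  assumes odd_pcol: "odd_pcol k S B f" and fin: "finite S" and x: "x \<notin> S" and "a < k"
    and proper: "\<forall>u\<in>nb S x. a \<noteq> f u"
    and odd: "\<forall>u\<in>nb S x - B'. a \<noteq> odd_col f (nb S u)"
    and odd_x: "x \<in> B' \<or> nb S x = {} \<or> odd_at f (nb S x)"
    and B: "S \<inter> B - B' \<subseteq> nb S x"
  shows "odd_pcol k (insert x S) B' (f(x := a))"
  unfolding odd_pcol_def
proof (intro conjI ballI impI)
  show "pcol k (insert x S) (f(x := a))"
    using odd_pcol proper x \<open>a < k\<close> by (intro pcol_insert) (auto simp: odd_pcol_def)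
next
  fix v assume v: "v \<in> insert x S - B'" and ne: "nb (insert x S) v \<noteq> {}"
  have cong: "odd_at (f(x := a)) (nb S v) \<longleftrightarrow> odd_at f (nb S v)"
    using x by (intro odd_at_cong) auto
  consider "v = x" | "v \<in> S" "v \<in> nb S x" | "v \<in> S" "v \<notin> nb S x" "v \<noteq> x"
    using v x by auto
  then show "odd_at (f(x := a)) (nb (insert x S) v)"
  proof cases
    case 1
    then have "nb (insert x S) v = nb S v" by (auto simp: nb_def)
    then show ?thesis using cong odd_x v ne 1 by auto
  next
    case 2
    then have "nb (insert x S) v = insert x (nb S v)" using E_sym[of x v] by (auto simp: nb_def)
    moreover have "odd_at (f(x := a)) (insert x (nb S v))"
      using 2 odd v x fin by (intro odd_at_insert) auto
    ultimately show ?thesis by simp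
  next
    case 3
    then have "nb (insert x S) v = nb S v" using E_sym[of x v] by (auto simp: nb_def)
    moreover have "v \<in> S - B" using 3 B v by blast
    ultimately show ?thesis using cong odd_pcol ne unfolding odd_pcol_def by metis
  qed
qed

text \<open>Each end of the attached path of length two forbids at most two colors.\<close>

lemma odd_pcol_attach:
  assumes odd_pcol: "odd_pcol k S B f" and fin: "finite S" and x: "x \<notin> S" and "k \<ge> 5"
    and pq: "nb S x = {p, q}" "f p \<noteq> f q"
    and B: "S \<inter> B \<subseteq> nb S x"
  shows "\<exists>a. odd_pcol k (insert x S) {} (f(x := a))"
proof -
  let ?F = "set [f p, f q, odd_col f (nb S p), odd_col f (nb S q)]"
  have "card ?F < k" using card_length[of "[f p, f q, odd_col f (nb S p), odd_col f (nb S q)]"] \<open>k \<ge> 5\<close>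
    by simp
  from ex_color_notin[OF this] obtain a where a: "a < k" "a \<notin> ?F" by auto
  have "odd_at f (nb S x)" using odd_at_pair[of f p q] pq by simp
  then have "odd_pcol k (insert x S) {} (f(x := a))"
    using a B unfolding pq(1)
    by (intro odd_pcol_insert[OF odd_pcol fin x]) (simp_all only: pq(1), auto)
  then show ?thesis ..
qed

text \<open>As \<open>T\<close> is independent, attaching one of its vertices leaves the
  neighbourhoods of the others unchanged. The first attached vertex is adjacent to all exempt
  vertices in \<open>S\<close> and ends their exemption, so the induction continues with the empty
  set in place of \<open>B\<close>.\<close>

lemma odd_pcol_attach_all:
  assumes "finite T" "finite S" "T \<inter> S = {}" "k \<ge> 5" "odd_pcol k S B f"
    and "\<forall>x\<in>T. nb T x = {} \<and> S \<inter> B \<subseteq> nb S x \<and> (\<exists>p q. nb S x = {p, q} \<and> f p \<noteq> f q)"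
    and "T \<noteq> {} \<or> S \<inter> B = {}"
  shows "\<exists>f'. odd_pcol k (S \<union> T) {} f'"
  using assms
proof (induction T arbitrary: S B f rule: finite_induct)
  case empty
  then have "S - B = S - {}" by blast
  then have "odd_pcol k S {} f" using empty.prems(4) by (simp add: odd_pcol_def)
  then show ?case by (intro exI[of _ f]) simp
next
  case (insert x T)
  from bspec[OF insert.prems(5) insertI1]
  obtain p q where B: "S \<inter> B \<subseteq> nb S x" and pq: "nb S x = {p, q}" "f p \<noteq> f q"
    by (elim conjE exE) (rule that)
  have x: "x \<notin> S" using insert.prems(2) by blast
  obtain a where a: "odd_pcol k (insert x S) {} (f(x := a))"
    using odd_pcol_attach[OF insert.prems(4,1) x insert.prems(3) pq B] by blast
  have "\<exists>f'. odd_pcol k (insert x S \<union> T) {} f'"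
  proof (rule insert.IH[OF _ _ _ a])
    show "\<forall>y\<in>T. nb T y = {} \<and> insert x S \<inter> {} \<subseteq> nb (insert x S) y \<and>
      (\<exists>p q. nb (insert x S) y = {p, q} \<and> (f(x := a)) p \<noteq> (f(x := a)) q)"
    proof
      fix y assume y: "y \<in> T"
      from bspec[OF insert.prems(5) insertI2[OF y]]
      obtain p q where y': "nb (insert x T) y = {}" and pq: "nb S y = {p, q}" "f p \<noteq> f q"
        by (elim conjE exE) (rule that)
      have "(y, x) \<notin> E" "nb T y = {}" using y' by (auto simp: nb_def)
      then have "nb (insert x S) y = {p, q}" using pq(1) by (auto simp: nb_def)
      moreover have "p \<noteq> x" "q \<noteq> x" using pq(1) x by (auto simp: nb_def)
      ultimately show "nb T y = {} \<and> insert x S \<inter> {} \<subseteq> nb (insert x S) y \<and>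
          (\<exists>p q. nb (insert x S) y = {p, q} \<and> (f(x := a)) p \<noteq> (f(x := a)) q)"
        using pq(2) \<open>nb T y = {}\<close> by auto
    qed
  qed (use insert.hyps insert.prems in auto)
  then show ?case by simp
qed

text \<open>Color \<open>S\<close> without \<open>v\<close> and \<open>T\<close>, then
  \<open>v\<close>, then \<open>T\<close>. Meanwhile \<open>v\<close> is exempt from parity:
  attaching \<open>T\<close> repairs it, and for empty \<open>T\<close> the parity of its degree
  does, unless \<open>v\<close> is isolated.\<close>

lemma reducible:
  assumes fin: "finite S" and v: "v \<in> S" and T: "T \<subseteq> nb S v"
    and T2: "\<And>w. w \<in> T \<Longrightarrow> card (nb S w) = 2 \<and> nb T w = {}"
    and deg: "2 * card (nb S v) < k + card T" and "k \<ge> 5"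
    and cases: "T \<noteq> {} \<or> odd (card (nb S v)) \<or> nb S v = {}"
    and smaller: "\<And>W. W \<subset> S \<Longrightarrow> \<exists>f. odd_pcol k W {} f"
  shows "\<exists>f. odd_pcol k S {} f"
proof -
  define S' where "S' = S - insert v T"
  have S': "S' \<subset> S" "finite S'" "v \<notin> S'" using fin v by (auto simp: S'_def)
  from smaller[OF S'(1)] obtain f where f: "odd_pcol k S' {} f" by blast
  have vT: "v \<notin> T" using T by auto
  have finT: "finite T" using T fin by (meson finite_nb finite_subset)
  have U: "nb S' v = nb S v - T" by (auto simp: S'_def nb_def)
  then have cU: "card (nb S' v) = card (nb S v) - card T" using finT T by (simp add: card_Diff_subset)
  have cT: "card T \<le> card (nb S v)" using T fin by (intro card_mono) auto
  have ends: "\<exists>u. nb S' w = {u} \<and> nb (insert v S') w = {v, u}" if w: "w \<in> T" for w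
  proof -
    have vw: "v \<in> nb S w" using w T E_sym[of v w] v by auto
    have nT: "nb T w = {}" using T2[OF w] by blast
    then have "nb S' w = nb S w - {v}" by (auto simp: S'_def nb_def)
    moreover from this have "card (nb S' w) = 1" using vw T2[OF w] fin by simp
    then obtain u where "nb S' w = {u}" by (auto simp: card_1_singleton_iff)
    moreover have "nb (insert v S') w = insert v (nb S' w)" using vw by (auto simp: nb_def)
    ultimately show ?thesis by auto
  qed
  \<comment> \<open>The colors forbidden for \<open>v\<close>: two for each remaining neighbour, and
    for each \<open>w\<close> in \<open>T\<close> the color of its other neighbour, so that
    \<open>w\<close> will see two distinct colors. With \<open>d\<close> the degree of
    \<open>v\<close> and \<open>t = card T\<close> this is at most
    \<open>2 * (d - t) + t\<close>.\<close>
  define F where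
    "F = f ` nb S' v \<union> (\<lambda>u. odd_col f (nb S' u)) ` nb S' v \<union> (\<Union>w\<in>T. f ` nb S' w)"
  have "card (\<Union>w\<in>T. f ` nb S' w) \<le> (\<Sum>w\<in>T. card (f ` nb S' w))"
    by (rule card_UN_le[OF finT])
  also have "\<dots> \<le> (\<Sum>w\<in>T. 1)" using ends by (intro sum_mono) fastforce
  finally have F3: "card (\<Union>w\<in>T. f ` nb S' w) \<le> card T" by simp
  have "card F \<le> card (f ` nb S' v) + card ((\<lambda>u. odd_col f (nb S' u)) ` nb S' v)
      + card (\<Union>w\<in>T. f ` nb S' w)"
    unfolding F_def by (intro order_trans[OF card_Un_le] add_right_mono card_Un_le)
  also have "\<dots> \<le> card (nb S' v) + card (nb S' v) + card T"
    using S'(2) F3 by (intro add_mono card_image_le) auto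
  also have "\<dots> < k" using cU cT deg by linarith
  finally have "card F < k" .
  moreover have "finite F" using S'(2) finT by (auto simp: F_def)
  ultimately obtain a where a: "a < k" "a \<notin> F" using ex_color_notin by blast
  define g where "g = f(v := a)"
  have g: "odd_pcol k (insert v S') {v} g"
    unfolding g_def using a by (intro odd_pcol_insert[OF f S'(2,3)]) (auto simp: F_def)
  have ST: "insert v S' \<union> T = S" using v T by (auto simp: S'_def)
  show ?thesis
  proof (cases "T = {}")
    case True
    then have S: "insert v S' = S" using ST by simp
    have "nb S v \<noteq> {} \<Longrightarrow> odd_at g (nb S v)"
      using cases True fin by (intro odd_at_if_odd_card) auto
    then have "odd_pcol k S {} g" using g unfolding odd_pcol_def S by blast
    then show ?thesis by blast
  next
    case False
    have "\<exists>f'. odd_pcol k (insert v S' \<union> T) {} f'"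
    proof (rule odd_pcol_attach_all[OF finT _ _ \<open>k \<ge> 5\<close> g])
      show "\<forall>x\<in>T. nb T x = {} \<and> insert v S' \<inter> {v} \<subseteq> nb (insert v S') x \<and>
        (\<exists>p q. nb (insert v S') x = {p, q} \<and> g p \<noteq> g q)"
      proof
        fix x assume x: "x \<in> T"
        then obtain u where u: "nb S' x = {u}" "nb (insert v S') x = {v, u}" using ends by blast
        have "u \<noteq> v" using u(1) S'(3) by (auto simp: nb_def)
        moreover have "f u \<noteq> a" using a(2) u(1) x by (auto simp: F_def)
        ultimately have "g v \<noteq> g u" by (simp add: g_def)
        then show "nb T x = {} \<and> insert v S' \<inter> {v} \<subseteq> nb (insert v S') x \<and>
          (\<exists>p q. nb (insert v S') x = {p, q} \<and> g p \<noteq> g q)"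
          using T2[OF x] u(2) by auto
      qed
    qed (use False S' vT in \<open>auto simp: S'_def\<close>)
    then show ?thesis using ST by simp
  qed
qed

end

section \<open>Discharging\<close>

text \<open>The vertices \<open>\<psi> e\<close> subdivide the edges \<open>e\<close> of a complete graph with vertex set \<open>K\<close>.\<close>

definition subdivided_clique :: "'a rel \<Rightarrow> 'a set \<Rightarrow> 'a set \<Rightarrow> ('a set \<Rightarrow> 'a) \<Rightarrow> bool" where
  "subdivided_clique E V K \<psi> \<longleftrightarrow> K \<subseteq> V \<and> inj_on \<psi> {e. e \<subseteq> K \<and> card e = 2} \<and>
     (\<forall>e. e \<subseteq> K \<and> card e = 2 \<longrightarrow> \<psi> e \<in> V - K \<and> (\<forall>x\<in>e. (x, \<psi> e) \<in> E))"

context simple_adjacency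
begin

text \<open>Double counting of the adjacent pairs between \<open>A\<close> and
  \<open>B\<close>.\<close>

lemma sum_card_nb_swap:
  assumes "finite A" "finite B"
  shows "(\<Sum>v\<in>A. card (nb B v)) = (\<Sum>w\<in>B. card (nb A w))"
proof -
  have card: "card (nb T v) = (\<Sum>w\<in>T. of_bool ((v, w) \<in> E))" if "finite T" for T v
  proof -
    have "nb T v = T \<inter> {w. (v, w) \<in> E}" by auto
    then show ?thesis using that by (simp add: sum_of_bool_eq)
  qed
  have "(\<Sum>v\<in>A. card (nb B v)) = (\<Sum>v\<in>A. \<Sum>w\<in>B. of_bool ((v, w) \<in> E))"
    using assms by (simp add: card)
  also have "\<dots> = (\<Sum>w\<in>B. \<Sum>v\<in>A. of_bool ((v, w) \<in> E))"
    by (rule sum.swap)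
  also have "\<dots> = (\<Sum>w\<in>B. \<Sum>v\<in>A. of_bool ((w, v) \<in> E))"
    by (intro sum.cong refl arg_cong[where f = of_bool] E_sym)
  also have "\<dots> = (\<Sum>w\<in>B. card (nb A w))"
    using assms by (simp add: card)
  finally show ?thesis .
qed

end

text \<open>
  The final charge of a vertex of degree \<open>d\<close> with \<open>t\<close> neighbours of degree two, scaled by
  \<open>k + 2\<close> and measured relative to the average: each of these neighbours receives
  \<open>(k - 2) / (k + 2)\<close>.
\<close>

lemma charge_nonneg:
  fixes k d t :: int
  assumes "k \<ge> 7" "d \<ge> 4" "0 \<le> t" "t \<le> d" "t > 0 \<Longrightarrow> k + t \<le> 2 * d"
  shows "(k + 2) * d - (k - 2) * t - 4 * k \<ge> 0"
    and "(k + 2) * d - (k - 2) * t - 4 * k = 0 \<Longrightarrow> d = k \<and> t = k"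
proof -
  let ?c = "(k + 2) * d - (k - 2) * t - 4 * k"
  consider "t = 0" | "t > 0" "d < k" | "t > 0" "d \<ge> k" using assms by linarith
  then have "?c \<ge> 0 \<and> (?c = 0 \<longrightarrow> d = k \<and> t = k)"
  proof cases
    case 1
    \<comment> \<open>With \<open>t = 0\<close> the value is at least \<open>8\<close>, so equality
      cannot occur.\<close>
    have "(k + 2) * 4 \<le> (k + 2) * d" using assms by (intro mult_left_mono) auto
    then show ?thesis using 1 by simp
  next
    case 2
    \<comment> \<open>The second factor of the last product is the slack in
      \<open>k + t \<le> 2 * d\<close>; the first product is positive because
      \<open>k \<ge> 7\<close>.\<close>
    have "?c = (k - 6) * (k - d) + (k - 2) * (2 * d - k - t)" by (simp add: algebra_simps)
    moreover have "(k - 6) * (k - d) > 0" using 2 assms by simp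
    moreover have "(k - 2) * (2 * d - k - t) \<ge> 0" using 2 assms by simp
    ultimately show ?thesis by linarith
  next
    case 3
    define s where "s = (k - 2) * (d - t)"
    have eq: "?c = 4 * (d - k) + s" by (simp add: s_def algebra_simps)
    have ge: "s \<ge> 0" using assms by (simp add: s_def)
    have "d = k \<and> t = k" if "?c = 0"
    proof -
      have sum: "4 * (d - k) + s = 0" using that eq by simp
      then have "d = k" using ge 3 by presburger
      with sum have "s = 0" by simp
      with \<open>d = k\<close> show ?thesis using assms by (simp add: s_def)
    qed
    moreover have "?c \<ge> 0" unfolding eq using ge 3 by simp
    ultimately show ?thesis by blast
  qed
  then show "?c \<ge> 0" "?c = 0 \<Longrightarrow> d = k \<and> t = k" by blast+
qed

section \<open>The equality case and the minimal counterexample\<close>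

context simple_adjacency
begin

text \<open>
  The structure forced by equality: \<open>L\<close> subdivides the edges of a multigraph on \<open>H\<close>, whose
  proper colorings extend.
\<close>

lemma odd_pcol_subdivision:
  assumes fin: "finite H" "finite L" and disj: "L \<inter> H = {}" and "k \<ge> 5"
    and H: "\<And>v. v \<in> H \<Longrightarrow> nb H v = {} \<and> card (nb L v) \<le> k"
    and L: "\<And>w. w \<in> L \<Longrightarrow> nb L w = {} \<and> card (nb H w) = 2"
    and no: "\<And>K \<psi>. card K = Suc k \<Longrightarrow> \<not> subdivided_clique E (H \<union> L) K \<psi>"
  shows "\<exists>f. odd_pcol k (H \<union> L) {} f"
proof -
  \<comment> \<open>The relation \<open>R\<close> undoes the subdivision and merges parallel edges,
    so that Brooks' theorem for simple graphs applies.\<close>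
  define R where "R = {(x, y). x \<noteq> y \<and> (\<exists>w\<in>L. nb H w = {x, y})}"
  interpret R: simple_adjacency R
    by unfold_locales (auto simp: R_def sym_def irrefl_def insert_commute)
  have deg: "\<forall>v\<in>H. card (R.nb H v) \<le> k"
  proof
    fix v assume v: "v \<in> H"
    \<comment> \<open>Each vertex of \<open>nb L v\<close> determines its other end, and every
      \<open>R\<close>-neighbour of \<open>v\<close> arises in this way.\<close>
    have "R.nb H v \<subseteq> (\<lambda>w. SOME y. nb H w = {v, y}) ` nb L v"
    proof
      fix y assume "y \<in> R.nb H v"
      then have "(v, y) \<in> R" by simp
      then obtain w where w: "w \<in> L" "nb H w = {v, y}" by (auto simp: R_def)
      then have "nb H w = {v, SOME y. nb H w = {v, y}}" by (intro someI)
      then have eq: "y = (SOME y. nb H w = {v, y})"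
        unfolding w(2) by (auto simp: doubleton_eq_iff)
      have "v \<in> nb H w" unfolding w(2) by simp
      then have "w \<in> nb L v" using w(1) E_sym[of v w] by simp
      with eq show "y \<in> (\<lambda>w. SOME y. nb H w = {v, y}) ` nb L v"
        by (rule image_eqI[where x = w])
    qed
    then have "card (R.nb H v) \<le> card (nb L v)" using fin by (intro surj_card_le) auto
    then show "card (R.nb H v) \<le> k" using H[OF v] by linarith
  qed
  have clique: "\<exists>x\<in>K. \<exists>y\<in>K. x \<noteq> y \<and> (x, y) \<notin> R" if K: "K \<subseteq> H" "card K = Suc k" for K
  proof (rule ccontr)
    assume "\<not> ?thesis"
    then have all: "(x, y) \<in> R" if "x \<in> K" "y \<in> K" "x \<noteq> y" for x y using that by blast
    define \<psi> where "\<psi> e = (SOME w. w \<in> L \<and> nb H w = e)" for e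
    have \<psi>: "\<psi> e \<in> L \<and> nb H (\<psi> e) = e" if e: "e \<subseteq> K" "card e = 2" for e
    proof -
      obtain x y where xy: "e = {x, y}" "x \<noteq> y" using e(2) by (auto simp: card_2_iff)
      then have "(x, y) \<in> R" using e(1) by (intro all) auto
      then have "\<exists>w. w \<in> L \<and> nb H w = e" using xy by (auto simp: R_def)
      then show ?thesis unfolding \<psi>_def by (rule someI_ex)
    qed
    have "subdivided_clique E (H \<union> L) K \<psi>"
      unfolding subdivided_clique_def
    proof (intro conjI allI impI ballI)
      \<comment> \<open>The edge is recovered from its subdivision vertex as the neighbourhood in
        \<open>H\<close>.\<close>
      show "inj_on \<psi> {e. e \<subseteq> K \<and> card e = 2}"
        by (rule inj_on_inverseI[of _ "nb H"]) (use \<psi> in blast)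
      show "\<psi> e \<in> H \<union> L - K" if "e \<subseteq> K \<and> card e = 2" for e
        using \<psi>[of e] that disj K(1) by blast
      show "(x, \<psi> e) \<in> E" if "e \<subseteq> K \<and> card e = 2" "x \<in> e" for e x
      proof -
        have "x \<in> nb H (\<psi> e)" using \<psi>[of e] that by simp
        then show ?thesis using E_sym[of x "\<psi> e"] by simp
      qed
    qed (use K in blast)
    then show False using no[OF K(2)] by blast
  qed
  obtain g where g: "R.pcol k H g"
    using R.brooks[OF fin(1) _ deg clique] \<open>k \<ge> 5\<close> by fastforce
  \<comment> \<open>This is immediate as \<open>H\<close> is independent. That \<open>g\<close> is
    proper for \<open>R\<close> gives every vertex of \<open>L\<close> two differently colored
    neighbours.\<close>
  have "odd_pcol k H {} g"
    using g H unfolding odd_pcol_def pcol_def R.pcol_def by (auto simp: nb_def)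
  moreover have "\<forall>w\<in>L. nb L w = {} \<and> H \<inter> {} \<subseteq> nb H w \<and> (\<exists>p q. nb H w = {p, q} \<and> g p \<noteq> g q)"
  proof
    fix w assume w: "w \<in> L"
    obtain p q where pq: "nb H w = {p, q}" "p \<noteq> q" using L[OF w] by (auto simp: card_2_iff)
    then have "(p, q) \<in> R" using w by (auto simp: R_def)
    moreover have "p \<in> H" "q \<in> H" using pq(1) by (auto simp: nb_def)
    ultimately have "g p \<noteq> g q" using g by (simp add: R.pcol_def)
    then show "nb L w = {} \<and> H \<inter> {} \<subseteq> nb H w \<and> (\<exists>p q. nb H w = {p, q} \<and> g p \<noteq> g q)"
      using L[OF w] pq(1) by auto
  qed
  ultimately show ?thesis
    using odd_pcol_attach_all[OF fin(2,1) disj \<open>k \<ge> 5\<close>, of "{}" g] by simp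
qed

text \<open>The density bound is required for every \<open>W\<close> and cleared of denominators.
  Like the absence of subdivided cliques it passes to subsets of \<open>V\<close>, so induction
  colors every proper subset.\<close>

theorem odd_pcol_sparse:
  assumes "finite V" "k \<ge> 7"
    and "\<And>W. W \<subseteq> V \<Longrightarrow> (k + 2) * (\<Sum>v\<in>W. card (nb W v)) \<le> 4 * k * card W"
    and "\<And>K \<psi>. card K = Suc k \<Longrightarrow> \<not> subdivided_clique E V K \<psi>"
  shows "\<exists>f. odd_pcol k V {} f"
  using assms
proof (induction V rule: finite_psubset_induct)
  case (psubset V)
  note fin = psubset.hyps and k = psubset.prems(1)
  have smaller: "\<exists>f. odd_pcol k W {} f" if W: "W \<subset> V" for W
  proof (rule psubset.IH[OF W k])
    show "(k + 2) * (\<Sum>v\<in>X. card (nb X v)) \<le> 4 * k * card X" if "X \<subseteq> W" for X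
      using psubset.prems(2) that W by blast
    show "\<not> subdivided_clique E W K \<psi>" if "card K = Suc k" for K \<psi>
    proof
      assume "subdivided_clique E W K \<psi>"
      then have "subdivided_clique E V K \<psi>" using W unfolding subdivided_clique_def by blast
      then show False using psubset.prems(3)[OF that] by blast
    qed
  qed
  show ?case
  proof (rule ccontr)
    assume cex: "\<not> (\<exists>f. odd_pcol k V {} f)"
    have irred: "k + card T \<le> 2 * card (nb V v)"
      if "v \<in> V" "T \<subseteq> nb V v" "\<And>w. w \<in> T \<Longrightarrow> card (nb V w) = 2 \<and> nb T w = {}"
        and "T \<noteq> {} \<or> odd (card (nb V v)) \<or> nb V v = {}" for v T
    proof (rule ccontr)
      assume "\<not> ?thesis"
      then have "2 * card (nb V v) < k + card T" by simp
      then show False using reducible[OF fin that(1-3) _ _ that(4) smaller] cex k by auto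
    qed
    have odd_deg: "k \<le> 2 * card (nb V v)" if "v \<in> V" "odd (card (nb V v)) \<or> nb V v = {}" for v
      using irred[of v "{}"] that by simp
    define L where "L = {v \<in> V. card (nb V v) = 2}"
    define H where "H = V - L"
    have V: "V = H \<union> L" "L \<inter> H = {}" "finite L" "finite H"
      using fin by (auto simp: H_def L_def)
    \<comment> \<open>Two adjacent vertices of degree two would give
      \<open>k + 1 \<le> 4\<close>.\<close>
    have L: "nb L w = {}" if w: "w \<in> L" for w
    proof (rule ccontr)
      assume "nb L w \<noteq> {}"
      then obtain u where u: "u \<in> nb L w" by blast
      have "k + card {u} \<le> 2 * card (nb V w)"
        by (rule irred) (use u w in \<open>auto simp: L_def nb_def\<close>)
      then show False using w k by (simp add: L_def)
    qed
    \<comment> \<open>Degrees \<open>0\<close>, \<open>1\<close> and \<open>3\<close> would give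
      \<open>k \<le> 6\<close> by \<open>odd_deg\<close>.\<close>
    have H4: "4 \<le> card (nb V v)" if v: "v \<in> H" for v
    proof -
      have "card (nb V v) \<noteq> 2" "v \<in> V" using v by (auto simp: H_def L_def)
      moreover have "card (nb V v) \<noteq> 1" "card (nb V v) \<noteq> 3"
        using odd_deg[OF \<open>v \<in> V\<close>] k by auto
      moreover have "card (nb V v) \<noteq> 0"
        using odd_deg[OF \<open>v \<in> V\<close>] k fin by auto
      ultimately show ?thesis by linarith
    qed
    have nbL: "nb H w = nb V w" if "w \<in> L" for w
      using L[OF that] V(1) by (auto simp: nb_def)
    have deg2: "card (nb V w) = 2" if "w \<in> L" for w
      using that by (simp add: L_def)
    define charge where
      "charge v = (int k + 2) * int (card (nb V v)) - (int k - 2) * int (card (nb L v)) - 4 * int k"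
      for v
    have tle: "card (nb L v) \<le> card (nb V v)" for v
      using fin V(1) by (intro card_nb_mono) auto
    have t: "int k + int (card (nb L v)) \<le> 2 * int (card (nb V v))"
      if v: "v \<in> H" "int (card (nb L v)) > 0" for v
    proof -
      have "nb L v \<noteq> {}" using v(2) by force
      moreover have "v \<in> V" "nb L v \<subseteq> nb V v" using v V(1) by auto
      moreover have "card (nb V w) = 2 \<and> nb (nb L v) w = {}" if "w \<in> nb L v" for w
        using that L[of w] by (auto simp: L_def nb_def)
      ultimately show ?thesis using irred[of v "nb L v"] by simp
    qed
    have charge: "charge v \<ge> 0" "charge v = 0 \<Longrightarrow> card (nb V v) = k \<and> card (nb L v) = k"
      if v: "v \<in> H" for v
      using charge_nonneg[of "int k" "int (card (nb V v))" "int (card (nb L v))"]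
        k H4[OF v] tle[of v] t[OF v] unfolding charge_def by auto
    have "(\<Sum>v\<in>H. card (nb L v)) = (\<Sum>w\<in>L. card (nb H w))"
      by (rule sum_card_nb_swap[OF V(4,3)])
    also have "\<dots> = (\<Sum>w\<in>L. 2)"
      by (rule sum.cong) (simp_all add: nbL deg2)
    finally have sumL: "(\<Sum>v\<in>H. card (nb L v)) = 2 * card L" by simp
    have "(\<Sum>v\<in>V. card (nb V v)) = (\<Sum>v\<in>H. card (nb V v)) + (\<Sum>v\<in>L. card (nb V v))"
      using V by (metis sum.union_disjoint inf_commute)
    also have "(\<Sum>v\<in>L. card (nb V v)) = (\<Sum>v\<in>L. 2)"
      by (rule sum.cong) (simp_all add: deg2)
    finally have sumV: "(\<Sum>v\<in>V. card (nb V v)) = (\<Sum>v\<in>H. card (nb V v)) + 2 * card L" by simp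
    have cV: "card V = card H + card L"
      using V by (metis card_Un_disjoint inf_commute)
    \<comment> \<open>Vertices of \<open>L\<close> end with
      \<open>2 * (k + 2) + 2 * (k - 2) - 4 * k = 0\<close>, so summing over \<open>H\<close> gives
      the total over \<open>V\<close>.\<close>
    have "(\<Sum>v\<in>H. charge v) = (int k + 2) * int (\<Sum>v\<in>H. card (nb V v))
        - (int k - 2) * int (\<Sum>v\<in>H. card (nb L v)) - 4 * int k * int (card H)"
      by (simp add: charge_def sum_subtractf sum_distrib_left)
    also have "\<dots> = int ((k + 2) * (\<Sum>v\<in>V. card (nb V v))) - int (4 * k * card V)"
      unfolding sumV sumL cV by (simp add: algebra_simps)
    also have "\<dots> \<le> 0"
      using psubset.prems(2)[OF subset_refl] by (simp only: diff_le_0_iff_le of_nat_le_iff)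
    finally have "(\<Sum>v\<in>H. charge v) \<le> 0" .
    moreover have "(\<Sum>v\<in>H. charge v) \<ge> 0" using charge(1) by (intro sum_nonneg)
    ultimately have "(\<Sum>v\<in>H. charge v) = 0" by linarith
    then have "\<forall>v\<in>H. charge v = 0" using sum_nonneg_eq_0_iff[OF V(4), of charge] charge(1) by blast
    then have tight: "card (nb V v) = k \<and> card (nb L v) = k" if "v \<in> H" for v
      using charge(2) that by blast
    have "nb H v = {} \<and> card (nb L v) \<le> k" if v: "v \<in> H" for v
    proof -
      have "nb L v = nb V v"
        using tight[OF v] fin V(1) by (intro card_subset_eq) auto
      moreover have "nb H v \<inter> nb L v = {}" "nb H v \<subseteq> nb V v" using V(1,2) by auto
      ultimately show ?thesis using tight[OF v] by auto
    qed
    moreover have "nb L w = {} \<and> card (nb H w) = 2" if "w \<in> L" for w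
      using L[OF that] nbL[OF that] deg2[OF that] by simp
    ultimately have "\<exists>f. odd_pcol k (H \<union> L) {} f"
      using odd_pcol_subdivision[OF V(4,3,2), of k] psubset.prems(3) k unfolding V(1)[symmetric] by simp
    then show False using cex V(1) by simp
  qed
qed

end

section \<open>The graph \<open>K_star\<close> and the maximum average degree\<close>

lemma simple_adjacency_parcs:
  assumes "pair_graph G"
  shows "simple_adjacency (parcs G)"
proof -
  interpret pair_graph G by fact
  show ?thesis
    by unfold_locales (auto simp: sym_def irrefl_def dest: arcs_symmetric no_loops')
qed

lemma card_parcs:
  assumes "pair_graph G"
  shows "card (parcs G) = 2 * card (uedges G)"
proof -
  interpret pair_graph G by fact
  let ?g = "\<lambda>a. {fst a, snd a}"
  have img: "?g ` parcs G = uedges G"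
  proof (intro set_eqI iffI)
    fix e assume "e \<in> ?g ` parcs G"
    then obtain u v where "(u, v) \<in> parcs G" "e = {u, v}" by auto
    then show "e \<in> uedges G" unfolding uedges_def by blast
  next
    fix e assume "e \<in> uedges G"
    then obtain u v where uv: "(u, v) \<in> parcs G" "e = {u, v}" by (auto simp: uedges_def)
    then have "e = ?g (u, v)" by simp
    then show "e \<in> ?g ` parcs G" using uv(1) by (rule image_eqI)
  qed
  have "card {a \<in> parcs G. ?g a = e} = 2" if e: "e \<in> uedges G" for e
  proof -
    obtain u v where uv: "e = {u, v}" "(u, v) \<in> parcs G" using e by (auto simp: uedges_def)
    have "{a \<in> parcs G. ?g a = e} = {(u, v), (v, u)}"
      using uv arcs_symmetric[of u v] by (auto simp: doubleton_eq_iff)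
    then show ?thesis using no_loops'[OF uv(2)] by simp
  qed
  then have "(\<Sum>e\<in>?g ` parcs G. \<Sum>a\<in>{a \<in> parcs G. ?g a = e}. 1 :: nat) = 2 * card (uedges G)"
    unfolding img by simp
  then show ?thesis using sum.image_gen[OF pair_finite_arcs, of "\<lambda>_. 1 :: nat" ?g] by simp
qed

definition densities :: "'a pair_pre_digraph \<Rightarrow> real set" where
  "densities G = {2 * real (card (uedges H)) / real (card (pverts H)) | H.
     pair_graph H \<and> subgraph (with_proj H) (with_proj G) \<and> pverts H \<noteq> {}}"

lemma mad_eq_Max: "mad G = Max (densities G)"
  by (simp add: mad_def densities_def)

text \<open>A subgraph is determined by its vertex set and arc set, each ranging over a finite power
  set.\<close>

lemma finite_densities:
  assumes "pair_graph G"
  shows "finite (densities G)"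
proof -
  interpret pair_graph G by fact
  let ?h = "\<lambda>(A, B). let H = \<lparr>pverts = A, parcs = B\<rparr> in
    2 * real (card (uedges H)) / real (card (pverts H))"
  have "densities G \<subseteq> ?h ` (Pow (pverts G) \<times> Pow (parcs G))"
  proof
    fix x assume "x \<in> densities G"
    then obtain H where H: "x = 2 * real (card (uedges H)) / real (card (pverts H))"
      "subgraph (with_proj H) (with_proj G)" by (auto simp: densities_def)
    have "x = ?h (pverts H, parcs H)" using H(1) by (cases H) simp
    moreover have "(pverts H, parcs H) \<in> Pow (pverts G) \<times> Pow (parcs G)"
      using H(2) by (auto simp: subgraph_def)
    ultimately show "x \<in> ?h ` (Pow (pverts G) \<times> Pow (parcs G))" by (rule image_eqI)
  qed
  then show ?thesis
    by (rule finite_subset) (simp add: pair_finite_verts pair_finite_arcs)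
qed

lemma subgraph_with_proj_iff:
  assumes "pair_graph G" "pair_graph H"
  shows "subgraph (with_proj H) (with_proj G) \<longleftrightarrow> pverts H \<subseteq> pverts G \<and> parcs H \<subseteq> parcs G"
proof -
  interpret G: pair_graph G by fact
  interpret H: pair_graph H by fact
  show ?thesis
    using G.wf_digraph_axioms H.wf_digraph_axioms by (simp add: subgraph_def compatible_def)
qed

text \<open>Compare \<open>mad G\<close> with the density of the subgraph induced by
  \<open>W\<close>: its degree sum counts its arcs, hence every edge twice.\<close>

lemma sum_degrees_le_mad:
  assumes "pair_graph G" "W \<subseteq> pverts G" "W \<noteq> {}"
  shows "real (\<Sum>v\<in>W. card (simple_adjacency.nb (parcs G) W v)) \<le> mad G * real (card W)"
proof -
  interpret pair_graph G by fact
  interpret simple_adjacency "parcs G" by (rule simple_adjacency_parcs) fact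
  let ?H = "\<lparr>pverts = W, parcs = parcs G \<inter> W \<times> W\<rparr>"
  have finW: "finite W" using assms(2) pair_finite_verts finite_subset by blast
  have H: "pair_graph ?H"
  proof
    show "symmetric (with_proj ?H)"
      by (auto simp: symmetric_def intro!: symI dest: arcs_symmetric)
  qed (use finW pair_finite_arcs in \<open>auto dest: no_loops'\<close>)
  then have "subgraph (with_proj ?H) (with_proj G)"
    using subgraph_with_proj_iff[OF assms(1) H] assms(2) by simp
  then have "2 * real (card (uedges ?H)) / real (card (pverts ?H)) \<in> densities G"
    using H assms(3) unfolding densities_def mem_Collect_eq by (intro exI[of _ ?H]) simp
  then have "2 * real (card (uedges ?H)) / real (card W) \<le> mad G"
    unfolding mad_eq_Max using Max_ge[OF finite_densities[OF assms(1)]] by simp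
  then have "2 * real (card (uedges ?H)) \<le> mad G * real (card W)"
    using finW assms(3) by (simp add: divide_le_eq card_gt_0_iff)
  moreover have "(\<Sum>v\<in>W. card (nb W v)) = card (SIGMA v:W. nb W v)"
    using finW by (simp add: card_SigmaI)
  moreover have "(SIGMA v:W. nb W v) = parcs ?H" by auto
  ultimately show ?thesis using card_parcs[OF H] by simp
qed

lemma odd_coloring_if_odd_pcol:
  assumes "pair_graph G" "simple_adjacency.odd_pcol (parcs G) c (pverts G) {} f"
  shows "odd_coloring G c f"
proof -
  interpret pair_graph G by fact
  interpret simple_adjacency "parcs G" by (rule simple_adjacency_parcs) fact
  have nbh: "neighborhood G v = nb (pverts G) v" for v
    by (auto simp: neighborhood_def in_arcsD2)
  have "nb (pverts G) v \<noteq> {}" if "out_degree (with_proj G) v > 0" for v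
  proof
    assume "nb (pverts G) v = {}"
    then have "out_arcs (with_proj G) v = {}" by (auto simp: out_arcs_def nbh[symmetric] neighborhood_def)
    then show False using that by (simp add: out_degree_def)
  qed
  moreover have "f u \<noteq> f v" if "(u, v) \<in> parcs G" for u v
    using assms(2) that in_arcsD1[OF that] in_arcsD2[OF that] unfolding odd_pcol_def pcol_def by blast
  ultimately show ?thesis
    using assms(2) unfolding odd_coloring_def odd_pcol_def pcol_def proper_coloring_def nbh odd_at_def
    by auto
qed

section \<open>Finding \<open>K_star\<close> as a subgraph\<close>

lemma uedges_complete_graph: "uedges (complete_graph n) = {e. e \<subseteq> {..<n} \<and> card e = 2}"
proof (intro set_eqI iffI)
  fix e assume "e \<in> uedges (complete_graph n)"
  then show "e \<in> {e. e \<subseteq> {..<n} \<and> card e = 2}"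
    by (auto simp: uedges_def complete_graph_def)
next
  fix e assume "e \<in> {e. e \<subseteq> {..<n} \<and> card e = 2}"
  then obtain u v where "e = {u, v}" "u \<noteq> v" "u < n" "v < n" by (auto simp: card_2_iff)
  then show "e \<in> uedges (complete_graph n)" by (auto simp: uedges_def complete_graph_def)
qed

lemma K_star_simps:
  "pverts (K_star n) = Inl ` {..<n} \<union> Inr ` uedges (complete_graph n)"
  "parcs (K_star n) = {(Inl u, Inr e) | u e. e \<in> uedges (complete_graph n) \<and> u \<in> e}
     \<union> {(Inr e, Inl u) | u e. e \<in> uedges (complete_graph n) \<and> u \<in> e}"
  by (simp_all add: K_star_def subdivide_all_def, simp add: complete_graph_def)

lemma contains_K_star:
  assumes G: "pair_graph G" and K: "card K = n" "n > 0"
    and sub: "subdivided_clique (parcs G) (pverts G) K \<psi>"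
  shows "contains_subgraph G (K_star n)"
proof -
  interpret pair_graph G by fact
  interpret S: pair_graph "K_star n" by (rule pair_graph_K_star)
  let ?P = "{e. e \<subseteq> K \<and> card e = 2}"
  \<comment> \<open>An infinite set has \<open>card\<close> zero, which \<open>n > 0\<close>
    excludes.\<close>
  have "finite K" using K by (simp add: card_ge_0_finite)
  then obtain h where h: "bij_betw h {..<n} K"
    using ex_bij_betw_nat_finite[of K] K(1) by (auto simp: atLeast0LessThan)
  have inj: "inj_on h {..<n}" and hK: "h ` {..<n} = K" using h by (auto simp: bij_betw_def)
  define \<phi> where "\<phi> = case_sum h (\<lambda>e. \<psi> (h ` e))"
  have edge: "h ` e \<in> ?P" if "e \<in> uedges (complete_graph n)" for e
  proof -
    have e: "e \<subseteq> {..<n}" "card e = 2" using that by (auto simp: uedges_complete_graph)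
    then have "card (h ` e) = 2" using card_image[OF inj_on_subset[OF inj e(1)]] by simp
    then show ?thesis using e(1) hK by auto
  qed
  have \<psi>: "\<psi> e \<in> pverts G - K" "\<And>x. x \<in> e \<Longrightarrow> (x, \<psi> e) \<in> parcs G" if "e \<in> ?P" for e
    using sub that unfolding subdivided_clique_def by blast+
  have KV: "K \<subseteq> pverts G" and \<psi>inj: "inj_on \<psi> ?P"
    using sub unfolding subdivided_clique_def by blast+
  have \<phi>inj: "inj_on \<phi> (pverts (K_star n))"
  proof (rule inj_onI)
    fix x y assume x: "x \<in> pverts (K_star n)" and y: "y \<in> pverts (K_star n)" and eq: "\<phi> x = \<phi> y"
    have new: "h u \<noteq> \<psi> (h ` e)" if "u < n" "e \<in> uedges (complete_graph n)" for u e
      using \<psi>(1)[OF edge[OF that(2)]] hK that(1) by (metis DiffD2 imageI lessThan_iff)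
    show "x = y"
    proof (cases x; cases y)
      fix u v assume "x = Inl u" "y = Inl v"
      then show ?thesis using x y eq inj by (auto simp: \<phi>_def K_star_simps dest: inj_onD)
    next
      fix u e assume "x = Inl u" "y = Inr e"
      then show ?thesis using x y eq new[of u e] by (auto simp: \<phi>_def K_star_simps)
    next
      fix u e assume "x = Inr e" "y = Inl u"
      then show ?thesis using x y eq new[of u e] by (auto simp: \<phi>_def K_star_simps)
    next
      fix e d assume xy: "x = Inr e" "y = Inr d"
      then have ed: "e \<in> uedges (complete_graph n)" "d \<in> uedges (complete_graph n)"
        using x y by (auto simp: K_star_simps)
      then have "h ` e = h ` d"
        using eq xy inj_onD[OF \<psi>inj _ edge edge] by (simp add: \<phi>_def)
      moreover have "e \<subseteq> {..<n}" "d \<subseteq> {..<n}" using ed by (auto simp: uedges_complete_graph)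
      ultimately show ?thesis using xy inj_on_image_eq_iff[OF inj] by simp
    qed
  qed
  \<comment> \<open>Only the images of the arcs of \<open>K_star n\<close> are kept, since the copy
    in \<open>G\<close> need not be induced.\<close>
  let ?H = "\<lparr>pverts = \<phi> ` pverts (K_star n), parcs = map_prod \<phi> \<phi> ` parcs (K_star n)\<rparr>"
  let ?hom = "\<lparr>iso_verts = \<phi>, iso_arcs = map_prod \<phi> \<phi>, iso_head = snd, iso_tail = fst\<rparr>"
  have "inj_on (map_prod \<phi> \<phi>) (parcs (K_star n))"
  proof (rule inj_on_subset)
    show "inj_on (map_prod \<phi> \<phi>) (pverts (K_star n) \<times> pverts (K_star n))"
      by (rule map_prod_inj_on[OF \<phi>inj \<phi>inj])
    show "parcs (K_star n) \<subseteq> pverts (K_star n) \<times> pverts (K_star n)"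
      by (auto dest: S.in_arcsD1 S.in_arcsD2)
  qed
  then have iso: "S.digraph_isomorphism ?hom"
    using \<phi>inj S.wf_digraph_axioms by (simp add: S.digraph_isomorphism_def)
  have app: "app_iso ?hom (with_proj (K_star n)) = with_proj ?H"
    by (simp add: app_iso_def with_proj_def)
  have "wf_digraph (with_proj ?H)"
    using S.wf_digraphI_app_iso[OF iso] app by simp
  moreover have "\<phi> ` pverts (K_star n) \<subseteq> pverts G"
    using KV hK \<psi>(1)[OF edge] by (auto simp: \<phi>_def K_star_simps)
  moreover have "map_prod \<phi> \<phi> ` parcs (K_star n) \<subseteq> parcs G"
  proof -
    have "(h u, \<psi> (h ` e)) \<in> parcs G" if "e \<in> uedges (complete_graph n)" "u \<in> e" for u e
      using \<psi>(2)[OF edge[OF that(1)]] that(2) by blast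
    then show ?thesis
      using arcs_symmetric by (auto simp: \<phi>_def K_star_simps)
  qed
  ultimately have "subgraph (with_proj ?H) (with_proj G)"
    using wf_digraph_axioms by (simp add: subgraph_def compatible_def)
  moreover have "digraph_iso (with_proj (K_star n)) (with_proj ?H)"
    unfolding digraph_iso_def using iso app by metis
  ultimately show ?thesis unfolding contains_subgraph_def by blast
qed

section \<open>The maximum average degree of \<open>K_star\<close>\<close>

definition incidences :: "('a + 'b) pair_pre_digraph \<Rightarrow> ('a \<times> 'b) set" where
  "incidences H = {(u, e). (Inl u, Inr e) \<in> parcs H}"

text \<open>Every edge joins an \<open>Inl\<close> vertex to an \<open>Inr\<close> vertex, and
  \<open>incidences H\<close> records just one of its two arcs.\<close>

lemma card_uedges_subgraph_K_star:
  assumes H: "pair_graph H" and sub: "parcs H \<subseteq> parcs (K_star n)"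
  shows "card (uedges H) = card (incidences H)"
proof -
  interpret pair_graph H by fact
  let ?X = "incidences H"
  define f g :: "nat \<times> nat set \<Rightarrow> (nat + nat set) \<times> (nat + nat set)"
    where "f = (\<lambda>(u, e). (Inl u, Inr e))" and "g = (\<lambda>(u, e). (Inr e, Inl u))"
  have "parcs H = f ` ?X \<union> g ` ?X"
  proof
    show "parcs H \<subseteq> f ` ?X \<union> g ` ?X"
    proof
      fix a assume a: "a \<in> parcs H"
      then have "(\<exists>u e. a = (Inl u, Inr e)) \<or> (\<exists>u e. a = (Inr e, Inl u))"
        using sub by (auto simp: K_star_simps)
      then consider u e where "a = f (u, e)" | u e where "a = g (u, e)"
        by (auto simp: f_def g_def)
      then show "a \<in> f ` ?X \<union> g ` ?X"
      proof cases
        case 1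
        then have "(u, e) \<in> ?X" using a by (simp add: incidences_def f_def)
        then show ?thesis using 1 by simp
      next
        case 2
        then have "(u, e) \<in> ?X" using a arcs_symmetric by (simp add: incidences_def g_def)
        then show ?thesis using 2 by simp
      qed
    qed
    show "f ` ?X \<union> g ` ?X \<subseteq> parcs H"
      using arcs_symmetric by (auto simp: incidences_def f_def g_def)
  qed
  moreover have inj: "inj_on f ?X" "inj_on g ?X" by (auto simp: inj_on_def f_def g_def)
  moreover have "f ` ?X \<inter> g ` ?X = {}" by (auto simp: f_def g_def)
  moreover have "finite (f ` ?X)" "finite (g ` ?X)"
    using pair_finite_arcs calculation(1) by simp_all
  moreover note card_image[OF inj(1)] card_image[OF inj(2)]
  ultimately have "card (parcs H) = card ?X + card ?X"
    by (simp add: card_Un_disjoint)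
  then show ?thesis using card_parcs[OF H] by simp
qed

lemma incidences_bounds:
  assumes H: "pair_graph H" and sub: "parcs H \<subseteq> parcs (K_star (Suc c))"
    and verts: "pverts H \<subseteq> pverts (K_star (Suc c))"
  defines "A \<equiv> {u. Inl u \<in> pverts H}" and "B \<equiv> {e. Inr e \<in> pverts H}"
  shows "card (pverts H) = card A + card B"
    and "card (incidences H) \<le> c * card A" and "card (incidences H) \<le> 2 * card B"
proof -
  interpret pair_graph H by fact
  have A: "A \<subseteq> {..<Suc c}" and B: "B \<subseteq> uedges (complete_graph (Suc c))"
    using verts by (auto simp: A_def B_def K_star_simps)
  have edges: "uedges (complete_graph (Suc c)) \<subseteq> Pow {..<Suc c}" by (auto simp: uedges_complete_graph)
  have fin: "finite A" "finite B" using A B edges by (auto intro: finite_subset)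
  have "pverts H = Inl ` A \<union> Inr ` B"
  proof -
    have "x \<in> Inl ` A \<union> Inr ` B" if "x \<in> pverts H" for x
      using that by (cases x) (auto simp: A_def B_def)
    then show ?thesis by (auto simp: A_def B_def)
  qed
  moreover have "card (Inl ` A \<union> Inr ` B :: (nat + nat set) set) =
      card (Inl ` A :: (nat + nat set) set) + card (Inr ` B :: (nat + nat set) set)"
    using fin by (intro card_Un_disjoint) auto
  ultimately show "card (pverts H) = card A + card B" by (simp add: card_image)
  have X: "u \<in> A \<and> e \<in> B \<and> u \<in> e" if "(u, e) \<in> incidences H" for u e
    using that sub by (auto simp: incidences_def A_def B_def K_star_simps dest: in_arcsD1 in_arcsD2)
  \<comment> \<open>An incidence at \<open>u\<close> is determined by the other end of the
    subdivided edge, for which there are \<open>c\<close> choices.\<close>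
  have "incidences H \<subseteq> (\<lambda>(u, v). (u, {u, v})) ` (SIGMA u:A. {..<Suc c} - {u})"
  proof
    fix a assume "a \<in> incidences H"
    then obtain u e where a: "a = (u, e)" and ue: "u \<in> A" "e \<in> B" "u \<in> e"
      using X by (cases a) auto
    then have "e \<subseteq> {..<Suc c}" "card e = 2" using B by (auto simp: uedges_complete_graph)
    then obtain v where "e = {u, v}" "u \<noteq> v" "v < Suc c" using ue(3) by (auto simp: card_2_iff)
    then show "a \<in> (\<lambda>(u, v). (u, {u, v})) ` (SIGMA u:A. {..<Suc c} - {u})"
      using a ue(1) by (intro image_eqI[where x = "(u, v)"]) auto
  qed
  then have "card (incidences H) \<le> card (SIGMA u:A. {..<Suc c} - {u})"
    using fin by (intro surj_card_le) auto
  also have "\<dots> = (\<Sum>u\<in>A. card ({..<Suc c} - {u}))" using fin by (simp add: card_SigmaI)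
  also have "\<dots> = (\<Sum>u\<in>A. c)" using A by (intro sum.cong) auto
  finally show "card (incidences H) \<le> c * card A" by (simp add: mult.commute)
  have finB: "finite e" "card e = 2" if "e \<in> B" for e
    using that B by (auto simp: uedges_complete_graph intro: finite_subset[of _ "{..<Suc c}"])
  have "incidences H \<subseteq> (SIGMA e:B. e)\<inverse>" using X by auto
  moreover have "finite (SIGMA e:B. e)" using fin finB by auto
  ultimately have "card (incidences H) \<le> card (SIGMA e:B. e)"
    by (metis card_inverse card_mono finite_converse)
  also have "\<dots> = (\<Sum>e\<in>B. card e)" using fin finB by (simp add: card_SigmaI)
  also have "\<dots> = (\<Sum>e\<in>B. 2)" using finB by (intro sum.cong) auto
  finally show "card (incidences H) \<le> 2 * card B" by simp
qed

lemma card_uedges_complete_graph: "card (uedges (complete_graph (Suc c))) = Suc c * c div 2"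
  unfolding uedges_complete_graph using n_subsets[of "{..<Suc c}" 2] by (simp add: choose_two)

text \<open>The bounds on \<open>incidences\<close> limit the density of every subgraph, and the
  whole graph attains the limit with \<open>c * (c + 1)\<close> edges on
  \<open>(c + 1) * (c + 2) / 2\<close> vertices.\<close>

lemma mad_K_star: "mad (K_star (Suc c)) = 4 * real c / (real c + 2)"
  unfolding mad_eq_Max
proof (rule Max_eqI)
  let ?S = "K_star (Suc c)" and ?U = "uedges (complete_graph (Suc c))"
  show "finite (densities ?S)" by (rule finite_densities[OF pair_graph_K_star])
  show "y \<le> 4 * real c / (real c + 2)" if y_in: "y \<in> densities ?S" for y
  proof -
    obtain H where y: "y = 2 * real (card (uedges H)) / real (card (pverts H))"
      and H: "pair_graph H" "subgraph (with_proj H) (with_proj ?S)" "pverts H \<noteq> {}"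
      using y_in unfolding densities_def by blast
    interpret H: pair_graph H by (rule H(1))
    have sub: "parcs H \<subseteq> parcs ?S" "pverts H \<subseteq> pverts ?S"
      using H(2) by (auto simp: subgraph_def)
    define m where "m = card (incidences H)"
    obtain a b where ab: "card (pverts H) = a + b" "m \<le> c * a" "m \<le> 2 * b"
      using incidences_bounds[OF H(1) sub] unfolding m_def by blast
    \<comment> \<open>The weights \<open>c\<close> and \<open>2\<close> on the two bounds make
      \<open>a\<close> and \<open>b\<close> appear with the same coefficient
      \<open>2 * c\<close>.\<close>
    have "c * m + 2 * m \<le> c * (2 * b) + 2 * (c * a)" using ab by (intro add_mono mult_left_mono) auto
    then have "2 * m * (c + 2) \<le> 4 * c * card (pverts H)" unfolding ab(1) by (simp add: algebra_simps)
    then have "real (2 * m * (c + 2)) \<le> real (4 * c * card (pverts H))" by (simp only: of_nat_le_iff)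
    moreover have "card (uedges H) = m"
      using card_uedges_subgraph_K_star[OF H(1) sub(1)] by (simp add: m_def)
    moreover have "card (pverts H) > 0" using H(3) H.pair_finite_verts by (simp add: card_gt_0_iff)
    ultimately show ?thesis unfolding y by (simp add: field_simps)
  qed
  show "4 * real c / (real c + 2) \<in> densities ?S"
  proof -
    have fin: "finite ?U" by (simp add: uedges_complete_graph)
    have U: "2 * card ?U = Suc c * c" unfolding card_uedges_complete_graph by simp
    have "card (pverts ?S) = card (Inl ` {..<Suc c} :: (nat + nat set) set) + card (Inr ` ?U :: (nat + nat set) set)"
      unfolding K_star_simps using fin by (intro card_Un_disjoint) auto
    then have V: "card (pverts ?S) = Suc c + card ?U" by (simp add: card_image)
    have "incidences ?S = (SIGMA e:?U. e)\<inverse>"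
      by (auto simp: incidences_def K_star_simps)
    then have "card (incidences ?S) = card (SIGMA e:?U. e)" by simp
    also have "\<dots> = (\<Sum>e\<in>?U. card e)"
      using fin by (intro card_SigmaI) (auto simp: uedges_complete_graph intro: finite_subset[of _ "{..<Suc c}"])
    also have "\<dots> = (\<Sum>e\<in>?U. 2)" by (intro sum.cong) (auto simp: uedges_complete_graph)
    finally have E: "card (uedges ?S) = Suc c * c"
      using card_uedges_subgraph_K_star[OF pair_graph_K_star, of "Suc c" "Suc c"] U by simp
    have "real (2 * card ?U) = real (Suc c * c)" using U by (simp only:)
    then have V': "real (card (pverts ?S)) = (real c + 1) * (real c + 2) / 2"
      unfolding V by (simp add: field_simps)
    have E': "real (card (uedges ?S)) = (real c + 1) * real c"
      unfolding E by (simp add: algebra_simps)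
    have "real c + 1 \<noteq> 0" "real c + 2 \<noteq> 0" by linarith+
    then have ne: "real c + 2 \<noteq> 0" "(real c + 1) * (real c + 2) / 2 \<noteq> 0" by simp_all
    have "4 * real c / (real c + 2) = 2 * real (card (uedges ?S)) / real (card (pverts ?S))"
      unfolding E' V' frac_eq_eq[OF ne] by (simp add: algebra_simps)
    moreover have "subgraph (with_proj ?S) (with_proj ?S)"
      using subgraph_with_proj_iff[OF pair_graph_K_star pair_graph_K_star] by blast
    moreover have "pverts ?S \<noteq> {}" by (auto simp: K_star_simps)
    ultimately show ?thesis
      unfolding densities_def mem_Collect_eq by (intro exI[of _ ?S]) (simp add: pair_graph_K_star)
  qed
qed

theorem theorem1p2:
  fixes c :: nat
  assumes "c \<ge> 7"
  shows "mad (K_star (c + 1)) = 4 * real c / (real c + 2) \<and>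
    (\<forall>G :: 'a pair_pre_digraph.
       pair_graph G \<longrightarrow> mad G \<le> mad (K_star (c + 1)) \<longrightarrow>
       \<not> contains_subgraph G (K_star (c + 1)) \<longrightarrow> \<chi>\<^sub>o G \<le> c)"
proof (intro conjI allI impI)
  show mad: "mad (K_star (c + 1)) = 4 * real c / (real c + 2)" using mad_K_star[of c] by simp
  fix G :: "'a pair_pre_digraph"
  assume G: "pair_graph G" and le: "mad G \<le> mad (K_star (c + 1))"
    and free: "\<not> contains_subgraph G (K_star (c + 1))"
  interpret pair_graph G by fact
  interpret simple_adjacency "parcs G" by (rule simple_adjacency_parcs) fact
  have "\<exists>f. odd_pcol c (pverts G) {} f"
  proof (rule odd_pcol_sparse[OF pair_finite_verts assms])
    fix W assume W: "W \<subseteq> pverts G"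
    show "(c + 2) * (\<Sum>v\<in>W. card (nb W v)) \<le> 4 * c * card W"
    \<comment> \<open>Densities are taken over non-empty subgraphs only. Treating
      \<open>W = {}\<close> apart also settles the graph without vertices, whose \<open>mad\<close>
      is unspecified.\<close>
    proof (cases "W = {}")
      case False
      have "real (\<Sum>v\<in>W. card (nb W v)) \<le> mad G * real (card W)"
        by (rule sum_degrees_le_mad[OF G W False])
      also have "\<dots> \<le> 4 * real c / (real c + 2) * real (card W)"
        using le mad by (intro mult_right_mono) auto
      finally have "real (\<Sum>v\<in>W. card (nb W v)) * (real c + 2) \<le> 4 * real c * real (card W)"
        by (simp add: pos_le_divide_eq del: of_nat_sum)
      then have "real ((c + 2) * (\<Sum>v\<in>W. card (nb W v))) \<le> real (4 * c * card W)"
        by (simp add: algebra_simps del: of_nat_sum)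
      then show ?thesis by (simp only: of_nat_le_iff)
    qed simp
  next
    fix K :: "'a set" and \<psi> assume "card K = Suc c"
    then show "\<not> subdivided_clique (parcs G) (pverts G) K \<psi>"
      using free contains_K_star[OF G, of K "c + 1" \<psi>] by auto
  qed
  then have "odd_colorable G c"
    using odd_coloring_if_odd_pcol[OF G] unfolding odd_colorable_def by blast
  then show "\<chi>\<^sub>o G \<le> c" unfolding odd_chromatic_number_def by (rule Least_le)
qed

end
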